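(* Let $n\in\mathbb{N}$ and $u:V^n\to\mathbb{R}$. The following properties are equivalent: (i) $u\in \mathrm{AMLE}(V^n)$, i.e. $u$ is an absolute minimizer for the functional $\mathrm{Lip}^n$ on $V^n$; (ii) $u$ satisfies the Comparison with Cones property in $V^n$; (iii) $u$ is infinity harmonic in $V^n\setminus V^0$; (iv) $u\in \mathrm{AM}(V^n)$, i.e. $u$ is an absolute minimizer for the functional $\mathcal{F}^n$ on $V^n$.
   Context: Let $q_1,q_2,q_3\in\mathbb{R}^2$ be the vertices of an equilateral triangle of side $1$, $V^0=\{q_1,q_2,q_3\}$, and $\psi_i(x)=q_i+\frac12(x-q_i)$ for $i=1,2,3$. For $n\in\mathbb{N}$, $V^n=\bigcup \psi_{w_1}\circ\dots\circ\psi_{w_n}(V^0)$, the union over all words $w=(w_1,\dots,w_n)\in\{1,2,3\}^n$. For $x,y\in V^n$ write $x\sim_n y$ ($x,y$ adjacent) iff the segment joining $x$ and $y$ is the image of a side of the initial triangle under some $\psi_{w_1}\circ\dots\circ\psi_{w_n}$. Set $\delta_n=2^{-n}$. For a nonempty $K\subset V^n\setminus V^0$: $\partial K=\{y\in V^n\setminus K:\ \exists x\in K,\ y\sim_n x\}$ and $\overline K=K\cup\partial K$. For $x,y\in\overline K$, $d_{n,K}(x,y)$ is the minimum of $N\delta_n$ over all finite paths $\{x=x_0,x_1,\dots,x_N=y\}$ with $x_i\sim_n x_{i+1}$ for $i=0,\dots,N-1$ that stay inside $K$, meaning $x_i\in K$ for $i=1,\dots,N-1$, and where a single edge joining two points of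 $\partial K$ is not an admissible path (so $N\ge 2$ if $x\ne y$ both lie in $\partial K$); $d_{n,K}(x,x)=0$, and $d_{n,K}(x,y)=+\infty$ if there is no such path. $K$ is connected if $d_{n,K}(x,y)<+\infty$ for all $x,y\in\overline K$. For a function $u$ on $V^n$: $\mathrm{Lip}^n(u,K)=\max_{x,y\in\overline K,\,x\ne y}\frac{|u(x)-u(y)|}{d_{n,K}(x,y)}$. For $x\in V^n\setminus V^0$: $\Delta_\infty^n u(x)=\max_{y\sim_n x}\{u(y)-u(x)\}+\min_{y\sim_n x}\{u(y)-u(x)\}$ and $\mathcal{F}^n(u,x)=\max_{y\sim_n x}\frac{|u(x)-u(y)|}{\delta_n}$. $u$ is infinity harmonic in $K\subset V^n\setminus V^0$ if $\Delta_\infty^n u(x)=0$ for all $x\in K$. $u$ is an absolute minimizer for $\mathrm{Lip}^n$ on $V^n$ if for every (nonempty) connected set $K\subset V^n\setminus V^0$ and every $v:V^n\to\mathbb{R}$ with $u=v$ on $\partial K$ one has $\mathrm{Lip}^n(u,K)\le\mathrm{Lip}^n(v,K)$; $\mathrm{AMLE}(V^n)$ is the set of these. $u$ satisfies the Comparison with Cones property in $V^n$ if for every (nonempty) connected $K\subset V^n\setminus V^0$, every $x_0\in\partial K$, $\lambda\ge0$ and $\alpha\in\mathbb{R}$: $u\le\lambda d_{n,K}(x_0,\cdot)+\alpha$ on $\partial K$ implies the same inequality on $K$, and $u\ge-\lambda d_{n,K}(x_0,\cdot)+\alpha$ on $\partial K$ implies the same inequality on $K$. $u$ is an absolute minimizer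 for $\mathcal{F}^n$ on $V^n$ if for every $x\in V^n\setminus V^0$ and every $v:V^n\to\mathbb{R}$ with $v(y)=u(y)$ for all $y\sim_n x$ one has $\mathcal{F}^n(u,x)\le\mathcal{F}^n(v,x)$; $\mathrm{AM}(V^n)$ is the set of these. *)

theory Defs
  imports "HOL-Analysis.Analysis"
begin

text \<open>
  The vertices of the initial triangle are a family \<open>q\<close> indexed by the three-element type \<open>3\<close>,
  so a word of length \<open>n\<close> over the alphabet is a list \<open>w :: 3 list\<close> with \<open>length w = n\<close>.
  A function on the vertex set \<open>V q n\<close> is represented by a total function on the plane;
  none of the notions below depends on its values outside \<open>V q n\<close>.
\<close>

definition psi :: "(3 \<Rightarrow> real^2) \<Rightarrow> 3 \<Rightarrow> real^2 \<Rightarrow> real^2" where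
  "psi q i x = q i + (1/2) *\<^sub>R (x - q i)"

definition psi_word :: "(3 \<Rightarrow> real^2) \<Rightarrow> 3 list \<Rightarrow> real^2 \<Rightarrow> real^2" where
  "psi_word q w = foldr (\<lambda>i f. psi q i \<circ> f) w id"

definition V :: "(3 \<Rightarrow> real^2) \<Rightarrow> nat \<Rightarrow> (real^2) set" where
  "V q n = (\<Union>w\<in>{w. length w = n}. psi_word q w ` range q)"

definition adj :: "(3 \<Rightarrow> real^2) \<Rightarrow> nat \<Rightarrow> real^2 \<Rightarrow> real^2 \<Rightarrow> bool" where
  "adj q n x y \<longleftrightarrow> x \<in> V q n \<and> y \<in> V q n \<and>
     (\<exists>w i j. length w = n \<and> i \<noteq> j \<and>
        closed_segment x y = psi_word q w ` closed_segment (q i) (q j))"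

definition delta :: "nat \<Rightarrow> real" where
  "delta n = 1 / 2 ^ n"

definition bdry :: "(3 \<Rightarrow> real^2) \<Rightarrow> nat \<Rightarrow> (real^2) set \<Rightarrow> (real^2) set" where
  "bdry q n K = {y \<in> V q n - K. \<exists>x\<in>K. adj q n y x}"

definition cl :: "(3 \<Rightarrow> real^2) \<Rightarrow> nat \<Rightarrow> (real^2) set \<Rightarrow> (real^2) set" where
  "cl q n K = K \<union> bdry q n K"

definition admissible_path ::
    "(3 \<Rightarrow> real^2) \<Rightarrow> nat \<Rightarrow> (real^2) set \<Rightarrow> real^2 \<Rightarrow> real^2 \<Rightarrow> nat \<Rightarrow> (nat \<Rightarrow> real^2) \<Rightarrow> bool" where
  "admissible_path q n K x y N p \<longleftrightarrow>
     p 0 = x \<and> p N = y \<and>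
     (\<forall>i<N. adj q n (p i) (p (Suc i))) \<and>
     (\<forall>i. 0 < i \<and> i < N \<longrightarrow> p i \<in> K) \<and>
     \<not> (N = 1 \<and> x \<in> bdry q n K \<and> y \<in> bdry q n K)"

text \<open>
  The infimum is a minimum whenever some admissible path exists (lengths are natural numbers
  scaled by \<open>delta n\<close>), and it is \<open>\<infinity>\<close> when there is none.
\<close>

definition dK :: "(3 \<Rightarrow> real^2) \<Rightarrow> nat \<Rightarrow> (real^2) set \<Rightarrow> real^2 \<Rightarrow> real^2 \<Rightarrow> ereal" where
  "dK q n K x y =
     (if x = y then 0
      else (INF N\<in>{N. \<exists>p. admissible_path q n K x y N p}. ereal (real N * delta n)))"

definition conn :: "(3 \<Rightarrow> real^2) \<Rightarrow> nat \<Rightarrow> (real^2) set \<Rightarrow> bool" where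
  "conn q n K \<longleftrightarrow> (\<forall>x\<in>cl q n K. \<forall>y\<in>cl q n K. dK q n K x y < \<infinity>)"

definition Lip :: "(3 \<Rightarrow> real^2) \<Rightarrow> nat \<Rightarrow> (real^2 \<Rightarrow> real) \<Rightarrow> (real^2) set \<Rightarrow> ereal" where
  "Lip q n u K =
     Max {ereal \<bar>u x - u y\<bar> / dK q n K x y | x y. x \<in> cl q n K \<and> y \<in> cl q n K \<and> x \<noteq> y}"

definition inf_laplacian :: "(3 \<Rightarrow> real^2) \<Rightarrow> nat \<Rightarrow> (real^2 \<Rightarrow> real) \<Rightarrow> real^2 \<Rightarrow> real" where
  "inf_laplacian q n u x =
     Max {u y - u x | y. adj q n y x} + Min {u y - u x | y. adj q n y x}"

definition Fn :: "(3 \<Rightarrow> real^2) \<Rightarrow> nat \<Rightarrow> (real^2 \<Rightarrow> real) \<Rightarrow> real^2 \<Rightarrow> real" where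
  "Fn q n u x = Max {\<bar>u x - u y\<bar> / delta n | y. adj q n y x}"

definition inf_harmonic :: "(3 \<Rightarrow> real^2) \<Rightarrow> nat \<Rightarrow> (real^2 \<Rightarrow> real) \<Rightarrow> (real^2) set \<Rightarrow> bool" where
  "inf_harmonic q n u K \<longleftrightarrow> (\<forall>x\<in>K. inf_laplacian q n u x = 0)"

definition AMLE :: "(3 \<Rightarrow> real^2) \<Rightarrow> nat \<Rightarrow> (real^2 \<Rightarrow> real) set" where
  "AMLE q n = {u. \<forall>K v. K \<noteq> {} \<and> K \<subseteq> V q n - V q 0 \<and> conn q n K \<and>
       (\<forall>y\<in>bdry q n K. u y = v y) \<longrightarrow> Lip q n u K \<le> Lip q n v K}"

definition comparison_with_cones :: "(3 \<Rightarrow> real^2) \<Rightarrow> nat \<Rightarrow> (real^2 \<Rightarrow> real) \<Rightarrow> bool" where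
  "comparison_with_cones q n u \<longleftrightarrow>
     (\<forall>K x0 l a. K \<noteq> {} \<and> K \<subseteq> V q n - V q 0 \<and> conn q n K \<and> x0 \<in> bdry q n K \<and> 0 \<le> (l::real) \<longrightarrow>
        ((\<forall>x\<in>bdry q n K. ereal (u x) \<le> ereal l * dK q n K x0 x + ereal a) \<longrightarrow>
           (\<forall>x\<in>K. ereal (u x) \<le> ereal l * dK q n K x0 x + ereal a)) \<and>
        ((\<forall>x\<in>bdry q n K. ereal (u x) \<ge> - ereal l * dK q n K x0 x + ereal a) \<longrightarrow>
           (\<forall>x\<in>K. ereal (u x) \<ge> - ereal l * dK q n K x0 x + ereal a)))"

definition AM :: "(3 \<Rightarrow> real^2) \<Rightarrow> nat \<Rightarrow> (real^2 \<Rightarrow> real) set" where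
  "AM q n = {u. \<forall>x\<in>V q n - V q 0. \<forall>v.
       (\<forall>y. adj q n y x \<longrightarrow> v y = u y) \<longrightarrow> Fn q n u x \<le> Fn q n v x}"

end

theory Submission
  imports Defs
begin

text \<open>
  Everything rests on one observation.  If \<open>a\<close> and \<open>b\<close> are neighbours of \<open>x\<close> at which \<open>u\<close> is
  smallest and largest, then the infinity Laplacian at \<open>x\<close> is \<open>u a + u b - 2 * u x\<close>.  So \<open>u\<close> is
  infinity harmonic at \<open>x\<close> iff \<open>u x\<close> is the midpoint of the values \<open>u a\<close> and \<open>u b\<close>, and then the
  steepest ascent and the steepest descent out of \<open>x\<close> have the same size.

  The midpoint is the only value at \<open>x\<close> that minimises the largest jump to the neighbours; this is
  the equivalence with the absolute minimisers of \<open>Fn\<close>.  Testing the cone comparison, or the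
  minimality of the Lipschitz constant, on the single point \<open>K = {x}\<close> also forces the
  midpoint value, because there distinct neighbours have distance \<open>\<delta>\<close> to \<open>x\<close> and \<open>2\<delta>\<close> to each other.

  Conversely, let \<open>u\<close> be infinity harmonic in a connected \<open>K\<close>.  Cone comparison is a maximum
  principle (\<open>cone_comparison_above\<close>): where \<open>u\<close> minus the cone is maximal on \<open>K\<close>, \<open>u\<close> cannot
  ascend faster than the slope of the cone, hence cannot descend faster either, so the next point on a
  geodesic towards the vertex of the cone is again a maximum point.  Minimality of the Lipschitz
  constant follows from a bound on single edges (\<open>edge_bound\<close>): an edge with jump \<open>s > 0\<close> at
  \<open>x \<in> K\<close> can be prolonged upwards and downwards with jumps at least \<open>s\<close>, and since \<open>K\<close> is finite both
  prolongations reach \<open>\<partial>K\<close> (\<open>ascent_to_boundary\<close>).  Between the two boundary points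
  reached, the values on \<open>\<partial>K\<close> alone have slope at least \<open>s / \<delta>\<close>, so every competitor
  has Lipschitz constant at least \<open>s / \<delta>\<close>.  Summing over the edges of geodesics gives the claim for all
  pairs of points.

  The geometry of the gasket enters only through the facts that the vertex set is finite, that
  adjacency is symmetric and irreflexive, and that no vertex is isolated.
\<close>

section \<open>The graph of level n\<close>

lemma psi_word_similarity:
  "\<exists>c s. s \<noteq> 0 \<and> psi_word q w = (\<lambda>x. c + s *\<^sub>R x)"
proof (induction w)
  case Nil
  have "psi_word q [] = (\<lambda>x. 0 + 1 *\<^sub>R x)"
    by (auto simp: psi_word_def)
  then show ?case
    by (metis zero_neq_one)
next
  case (Cons i w)
  then obtain c s where s: "s \<noteq> 0" and w: "psi_word q w = (\<lambda>x. c + s *\<^sub>R x)"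
    by blast
  have "psi_word q (i # w) = psi q i \<circ> psi_word q w"
    by (simp add: psi_word_def)
  also have "\<dots> = (\<lambda>x. ((1/2) *\<^sub>R q i + (1/2) *\<^sub>R c) + (s/2) *\<^sub>R x)"
    by (rule ext) (simp add: w psi_def algebra_simps flip: scaleR_add_left)
  finally have "psi_word q (i # w) = (\<lambda>x. ((1/2) *\<^sub>R q i + (1/2) *\<^sub>R c) + (s/2) *\<^sub>R x)" .
  moreover have "s / 2 \<noteq> 0"
    using s by simp
  ultimately show ?case
    by blast
qed

lemma psi_word_closed_segment:
  "psi_word q w ` closed_segment a b = closed_segment (psi_word q w a) (psi_word q w b)"
proof -
  obtain c s where w: "psi_word q w = (\<lambda>x. c + s *\<^sub>R x)"
    using psi_word_similarity by blast
  have "psi_word q w ` closed_segment a b = (+) c ` (\<lambda>x. s *\<^sub>R x) ` closed_segment a b"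
    by (simp add: w image_image)
  also have "\<dots> = closed_segment (c + s *\<^sub>R a) (c + s *\<^sub>R b)"
    by (simp add: closed_segment_linear_image closed_segment_translation linear_scaleR)
  finally show ?thesis
    by (simp add: w)
qed

lemma inj_psi_word: "inj (psi_word q w)"
  using psi_word_similarity[of q w] by (auto simp: inj_def)

lemma finite_V: "finite (V q n)"
proof -
  have "finite {w :: 3 list. length w = n}"
    using finite_lists_length_eq[of "UNIV :: 3 set" n] by simp
  then show ?thesis
    by (simp add: V_def)
qed

lemma adj_sym: "adj q n x y \<Longrightarrow> adj q n y x"
  by (auto simp: adj_def closed_segment_commute)

lemma adj_in_V: "adj q n x y \<Longrightarrow> x \<in> V q n" "adj q n x y \<Longrightarrow> y \<in> V q n"
  by (auto simp: adj_def)

lemma adj_irrefl: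
  assumes "inj q"
  shows "\<not> adj q n x x"
proof
  assume "adj q n x x"
  then obtain w i j where ij: "i \<noteq> j"
    and eq: "{x} = psi_word q w ` closed_segment (q i) (q j)"
    by (auto simp: adj_def)
  have "psi_word q w (q i) \<in> {x}" "psi_word q w (q j) \<in> {x}"
    unfolding eq by auto
  then have "q i = q j"
    using inj_psi_word[of q w] by (metis injD singletonD)
  with ij assms show False
    by (simp add: inj_eq)
qed

lemma ex_neighbour:
  assumes "x \<in> V q n"
  shows "\<exists>y. adj q n y x"
proof -
  obtain w i where w: "length w = n" and x: "x = psi_word q w (q i)"
    using assms by (auto simp: V_def)
  have "i + 1 \<noteq> i"
    by simp
  moreover have "psi_word q w (q (i + 1)) \<in> V q n"
    using w by (auto simp: V_def)
  ultimately have "adj q n (psi_word q w (q (i + 1))) x"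
    using assms w psi_word_closed_segment unfolding adj_def x by metis
  then show ?thesis
    by blast
qed

lemma finite_neighbours: "finite {y. adj q n y x}"
  by (rule finite_subset[OF _ finite_V[of q n]]) (auto dest: adj_in_V)

lemma delta_pos: "0 < delta n"
  by (simp add: delta_def)

section \<open>Extremal neighbours\<close>

lemma obtain_extremal_neighbours:
  fixes u :: "real^2 \<Rightarrow> real"
  assumes "x \<in> V q n"
  obtains a b where "adj q n a x" "adj q n b x"
    "\<And>y. adj q n y x \<Longrightarrow> u a \<le> u y \<and> u y \<le> u b"
proof -
  let ?N = "{y. adj q n y x}"
  have fin: "finite (u ` ?N)" and ne: "u ` ?N \<noteq> {}"
    using finite_neighbours ex_neighbour[OF assms] by auto
  obtain a where "a \<in> ?N" "u a = Min (u ` ?N)"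
    using Min_in[OF fin ne] by auto
  moreover obtain b where "b \<in> ?N" "u b = Max (u ` ?N)"
    using Max_in[OF fin ne] by auto
  ultimately show ?thesis
    using that[of a b] Min_le[OF fin] Max_ge[OF fin] by simp
qed

lemma inf_laplacian_extremal:
  assumes "adj q n a x" "adj q n b x" "\<And>y. adj q n y x \<Longrightarrow> u a \<le> u y \<and> u y \<le> u b"
  shows "inf_laplacian q n u x = u a + u b - 2 * u x"
proof -
  have fin: "finite {u y - u x | y. adj q n y x}"
    using finite_neighbours by auto
  have "Max {u y - u x | y. adj q n y x} = u b - u x"
    using assms by (intro Max_eqI fin) auto
  moreover have "Min {u y - u x | y. adj q n y x} = u a - u x"
    using assms by (intro Min_eqI fin) auto
  ultimately show ?thesis
    by (simp add: inf_laplacian_def)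
qed

text \<open>The two halves of the balance: an infinity harmonic function falls somewhere at least as
  steeply as it rises anywhere, and conversely.\<close>

lemma harmonic_balance:
  assumes "inf_laplacian q n u x = 0" "adj q n y x"
  shows "\<exists>a. adj q n a x \<and> u y - u x \<le> u x - u a"
    and "\<exists>b. adj q n b x \<and> u x - u y \<le> u b - u x"
proof -
  obtain a b where ab: "adj q n a x" "adj q n b x"
    "\<And>y. adj q n y x \<Longrightarrow> u a \<le> u y \<and> u y \<le> u b"
    using obtain_extremal_neighbours[of x q n u] assms(2) adj_in_V(2) by blast
  have "u a + u b - 2 * u x = 0"
    using inf_laplacian_extremal[of q n a x b u] ab assms(1) by simp
  with ab(3)[OF assms(2)] have "u y - u x \<le> u x - u a" "u x - u y \<le> u b - u x"
    by linarith+
  with ab show "\<exists>a. adj q n a x \<and> u y - u x \<le> u x - u a"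
    "\<exists>b. adj q n b x \<and> u x - u y \<le> u b - u x"
    by blast+
qed

lemma inf_laplacian_uminus:
  assumes "x \<in> V q n"
  shows "inf_laplacian q n (\<lambda>y. - u y) x = - inf_laplacian q n u x"
proof -
  obtain a b where ab: "adj q n a x" "adj q n b x"
    "\<And>y. adj q n y x \<Longrightarrow> u a \<le> u y \<and> u y \<le> u b"
    using obtain_extremal_neighbours[OF assms, of u] by blast
  have "inf_laplacian q n u x = u a + u b - 2 * u x"
    by (rule inf_laplacian_extremal) (use ab in auto)
  moreover have "inf_laplacian q n (\<lambda>y. - u y) x = - u b + - u a - 2 * - u x"
    by (rule inf_laplacian_extremal) (use ab in auto)
  ultimately show ?thesis
    by simp
qed

lemma inf_harmonic_uminus:
  assumes "inf_harmonic q n u K" "K \<subseteq> V q n"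
  shows "inf_harmonic q n (\<lambda>y. - u y) K"
  using assms inf_laplacian_uminus unfolding inf_harmonic_def by fastforce

lemma Fn_le_iff:
  assumes "x \<in> V q n"
  shows "Fn q n v x \<le> c \<longleftrightarrow> (\<forall>y. adj q n y x \<longrightarrow> \<bar>v x - v y\<bar> \<le> c * delta n)"
proof -
  let ?S = "{\<bar>v x - v y\<bar> / delta n | y. adj q n y x}"
  have "finite ?S" "?S \<noteq> {}"
    using finite_neighbours ex_neighbour[OF assms] by auto
  then have "Fn q n v x \<le> c \<longleftrightarrow> (\<forall>t\<in>?S. t \<le> c)"
    unfolding Fn_def by (rule Max_le_iff)
  also have "\<dots> \<longleftrightarrow> (\<forall>y. adj q n y x \<longrightarrow> \<bar>v x - v y\<bar> \<le> c * delta n)"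
    using delta_pos[of n] by (auto simp: pos_divide_le_eq)
  finally show ?thesis .
qed

text \<open>Only the smallest and the largest neighbouring value constrain the value at \<open>x\<close>, and the
  midpoint between them is the unique value with the smallest largest jump.\<close>

lemma AM_iff_inf_harmonic:
  assumes "inj q"
  shows "u \<in> AM q n \<longleftrightarrow> inf_harmonic q n u (V q n - V q 0)"
proof
  assume AM: "u \<in> AM q n"
  show "inf_harmonic q n u (V q n - V q 0)"
    unfolding inf_harmonic_def
  proof
    fix x assume x: "x \<in> V q n - V q 0"
    then have xV: "x \<in> V q n"
      by simp
    obtain a b where ab: "adj q n a x" "adj q n b x"
      "\<And>y. adj q n y x \<Longrightarrow> u a \<le> u y \<and> u y \<le> u b"
      using obtain_extremal_neighbours[OF xV, of u] by blast
    define v where "v = u(x := (u a + u b) / 2)"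
    define c where "c = (u b - u a) / 2 / delta n"
    have c: "c * delta n = (u b - u a) / 2"
      using delta_pos[of n] by (simp add: c_def)
    have v: "v y = u y" if "adj q n y x" for y
      using that adj_irrefl[OF assms] by (auto simp: v_def)
    have "Fn q n v x \<le> c"
      unfolding Fn_le_iff[OF xV] c
    proof (intro allI impI)
      fix y assume y: "adj q n y x"
      have "v x = (u a + u b) / 2"
        by (simp add: v_def)
      then show "\<bar>v x - v y\<bar> \<le> (u b - u a) / 2"
        using ab(3)[OF y] v[OF y] by (auto simp: abs_if)
    qed
    moreover have "Fn q n u x \<le> Fn q n v x"
      using AM x v unfolding AM_def by blast
    ultimately have "Fn q n u x \<le> c"
      by linarith
    then have "\<bar>u x - u a\<bar> \<le> (u b - u a) / 2" "\<bar>u x - u b\<bar> \<le> (u b - u a) / 2"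
      unfolding Fn_le_iff[OF xV] c using ab by blast+
    then have "u a + u b - 2 * u x = 0"
      by (auto simp: abs_if split: if_splits)
    then show "inf_laplacian q n u x = 0"
      using inf_laplacian_extremal[of q n a x b u] ab by simp
  qed
next
  assume harm: "inf_harmonic q n u (V q n - V q 0)"
  have "Fn q n u x \<le> Fn q n v x"
    if x: "x \<in> V q n - V q 0" and v: "\<forall>y. adj q n y x \<longrightarrow> v y = u y" for x v
  proof -
    have xV: "x \<in> V q n"
      using x by simp
    obtain a b where ab: "adj q n a x" "adj q n b x"
      "\<And>y. adj q n y x \<Longrightarrow> u a \<le> u y \<and> u y \<le> u b"
      using obtain_extremal_neighbours[OF xV, of u] by blast
    have bal: "u a + u b - 2 * u x = 0"
      using inf_laplacian_extremal[of q n a x b u] ab harm x by (simp add: inf_harmonic_def)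
    have "\<bar>v x - u a\<bar> \<le> Fn q n v x * delta n" "\<bar>v x - u b\<bar> \<le> Fn q n v x * delta n"
      using Fn_le_iff[OF xV, of v "Fn q n v x"] ab v by fastforce+
    then have "(u b - u a) / 2 \<le> Fn q n v x * delta n"
      by (simp add: abs_le_iff)
    then show ?thesis
      unfolding Fn_le_iff[OF xV] using ab(3) bal by (auto simp: abs_le_iff) fastforce+
  qed
  then show "u \<in> AM q n"
    unfolding AM_def by blast
qed

section \<open>The path metric of a connected set\<close>

text \<open>The path metric in units of \<open>\<delta>\<close>.  Being a natural number, it is attained by a geodesic
  as soon as there is any path; for \<open>x = y\<close> the constant path of length \<open>0\<close> makes it vanish.
  When no path exists the value is arbitrary, so it is only meaningful for points joined by a path.\<close>

definition steps :: "(3 \<Rightarrow> real^2) \<Rightarrow> nat \<Rightarrow> (real^2) set \<Rightarrow> real^2 \<Rightarrow> real^2 \<Rightarrow> nat" where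
  "steps q n K x y = (LEAST N. \<exists>p. admissible_path q n K x y N p)"

lemma admissible_path_refl: "admissible_path q n K x x 0 (\<lambda>_. x)"
  by (simp add: admissible_path_def)

lemma steps_refl [simp]: "steps q n K x x = 0"
  using admissible_path_refl unfolding steps_def by (intro Least_eq_0) blast

lemma steps_le: "admissible_path q n K x y N p \<Longrightarrow> steps q n K x y \<le> N"
  unfolding steps_def by (rule Least_le) blast

lemma steps_path:
  assumes "admissible_path q n K x y N p"
  shows "\<exists>p. admissible_path q n K x y (steps q n K x y) p"
  unfolding steps_def by (rule LeastI_ex) (use assms in blast)

lemma dK_eq_steps_if_path:
  assumes "admissible_path q n K x y N p"
  shows "dK q n K x y = ereal (real (steps q n K x y) * delta n)"
proof (cases "x = y")
  case False
  have "(INF N\<in>{N. \<exists>p. admissible_path q n K x y N p}. ereal (real N * delta n))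
      = ereal (real (steps q n K x y) * delta n)"
  proof (rule INF_eqI)
    show "ereal (real (steps q n K x y) * delta n) \<le> ereal (real N * delta n)"
      if "N \<in> {N. \<exists>p. admissible_path q n K x y N p}" for N
      using that steps_le delta_pos[of n] by auto
  qed (use steps_path[OF assms] in blast)
  then show ?thesis
    using False by (simp add: dK_def)
qed (simp add: dK_def zero_ereal_def)

lemma conn_path:
  assumes "conn q n K" "x \<in> cl q n K" "y \<in> cl q n K"
  shows "\<exists>p. admissible_path q n K x y (steps q n K x y) p"
proof (cases "x = y")
  case False
  have "\<exists>N p. admissible_path q n K x y N p"
  proof (rule ccontr)
    assume "\<not> ?thesis"
    then have "{N. \<exists>p. admissible_path q n K x y N p} = {}"
      by blast
    then have "dK q n K x y = \<infinity>"
      unfolding dK_def using False by (simp only: image_empty Inf_empty top_ereal_def if_False)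
    then show False
      using assms by (auto simp: conn_def)
  qed
  then show ?thesis
    using steps_path by blast
next
  case True
  then show ?thesis
    by (intro exI[of _ "\<lambda>_. y"]) (simp add: admissible_path_refl)
qed

lemma dK_eq_steps:
  assumes "conn q n K" "x \<in> cl q n K" "y \<in> cl q n K"
  shows "dK q n K x y = ereal (real (steps q n K x y) * delta n)"
  using conn_path[OF assms] dK_eq_steps_if_path by blast

lemma steps_pos:
  assumes "conn q n K" "x \<in> cl q n K" "y \<in> cl q n K" "x \<noteq> y"
  shows "0 < steps q n K x y"
proof (rule ccontr)
  assume "\<not> 0 < steps q n K x y"
  then show False
    using conn_path[OF assms(1-3)] assms(4) by (auto simp: admissible_path_def)
qed

lemma admissible_path_reverse:
  assumes "admissible_path q n K x y N p"
  shows "admissible_path q n K y x N (\<lambda>i. p (N - i))"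
proof -
  have "adj q n (p (N - i)) (p (N - Suc i))" if "i < N" for i
  proof -
    have "Suc (N - Suc i) = N - i" "N - Suc i < N"
      using that by auto
    then show ?thesis
      using assms adj_sym unfolding admissible_path_def by metis
  qed
  then show ?thesis
    using assms by (auto simp: admissible_path_def)
qed

lemma steps_sym: "steps q n K x y = steps q n K y x"
proof -
  have "(\<exists>p. admissible_path q n K x y N p) \<longleftrightarrow> (\<exists>p. admissible_path q n K y x N p)" for N
    by (meson admissible_path_reverse)
  then show ?thesis
    by (simp add: steps_def)
qed

text \<open>Paths may be concatenated at points of \<open>K\<close> only, since a path must not pass through the
  boundary.\<close>

lemma admissible_path_append:
  assumes p: "admissible_path q n K x z N p" and r: "admissible_path q n K z y M r"
    and z: "z \<in> K"
  shows "admissible_path q n K x y (N + M) (\<lambda>i. if i \<le> N then p i else r (i - N))"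
    (is "admissible_path q n K x y _ ?s")
proof -
  have ends: "p N = z" "r 0 = z"
    using p r by (auto simp: admissible_path_def)
  have "adj q n (?s i) (?s (Suc i))" if i: "i < N + M" for i
  proof -
    consider "i < N" | "i = N" "0 < M" | "N < i" "i - N < M"
      using i by atomize_elim auto
    then show ?thesis
      using p r ends by cases (auto simp: admissible_path_def Suc_diff_le)
  qed
  moreover have "?s i \<in> K" if i: "0 < i" "i < N + M" for i
  proof -
    consider "i < N" | "i = N" | "N < i" "i - N < M"
      using i by atomize_elim auto
    then show ?thesis
      using p r ends z i by cases (auto simp: admissible_path_def)
  qed
  moreover have "\<not> (N + M = 1 \<and> x \<in> bdry q n K \<and> y \<in> bdry q n K)"
  proof
    assume *: "N + M = 1 \<and> x \<in> bdry q n K \<and> y \<in> bdry q n K"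
    then have "N = 0 \<or> M = 0"
      by linarith
    then have "x = z \<or> y = z"
      using p r by (auto simp: admissible_path_def)
    with * z show False
      by (auto simp: bdry_def)
  qed
  ultimately show ?thesis
    using p r ends by (auto simp: admissible_path_def)
qed

lemma steps_triangle:
  assumes "conn q n K" "x \<in> cl q n K" "y \<in> cl q n K" "z \<in> K"
  shows "steps q n K x y \<le> steps q n K x z + steps q n K z y"
proof -
  have "z \<in> cl q n K"
    using assms by (simp add: cl_def)
  then show ?thesis
    using conn_path[OF assms(1,2)] conn_path[OF assms(1) _ assms(3)]
      admissible_path_append[OF _ _ assms(4)] steps_le by meson
qed

lemma admissible_path_edge:
  assumes "adj q n x y" "x \<in> K \<or> y \<in> K"
  shows "admissible_path q n K x y 1 (\<lambda>i. if i = 0 then x else y)"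
  using assms by (auto simp: admissible_path_def bdry_def)

lemma neighbour_in_cl:
  assumes "x \<in> K" "adj q n y x"
  shows "y \<in> cl q n K"
  using assms adj_in_V(1) unfolding cl_def bdry_def by blast

lemma steps_edge:
  assumes "conn q n K" "x \<in> cl q n K" "z \<in> K" "adj q n y z"
  shows "steps q n K x y \<le> steps q n K x z + 1"
proof -
  have "steps q n K z y \<le> 1"
    using steps_le[OF admissible_path_edge[OF adj_sym[OF assms(4)]]] assms(3) by blast
  then show ?thesis
    using steps_triangle[of q n K x y z] neighbour_in_cl[of z K q n y] assms by linarith
qed

text \<open>The last vertex before \<open>x\<close> on a geodesic from \<open>z\<close>.\<close>

lemma closer_neighbour:
  assumes "conn q n K" "z \<in> bdry q n K" "x \<in> K"
  shows "\<exists>y. adj q n y x \<and> steps q n K z y + 1 \<le> steps q n K z x"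
proof -
  have cl: "z \<in> cl q n K" "x \<in> cl q n K" and "z \<noteq> x"
    using assms by (auto simp: cl_def bdry_def)
  then have "0 < steps q n K z x"
    using steps_pos assms(1) by blast
  then obtain N where N: "steps q n K z x = Suc N"
    using gr0_implies_Suc by blast
  obtain p where p: "admissible_path q n K z x (Suc N) p"
    using conn_path[OF assms(1) cl] N by auto
  have "p N \<in> K" if "N > 0"
    using p that by (simp add: admissible_path_def)
  then have "admissible_path q n K z (p N) N p"
    using p by (auto simp: admissible_path_def bdry_def)
  then have "steps q n K z (p N) \<le> N"
    by (rule steps_le)
  moreover have "adj q n (p N) x"
    using p by (auto simp: admissible_path_def)
  ultimately show ?thesis
    using N by auto
qed

text \<open>This is where the exclusion of a direct edge between two boundary points matters: it lets
  a local estimate around the points of \<open>K\<close> control every edge of a path.\<close>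

lemma admissible_path_edge_meets:
  assumes "admissible_path q n K x y N p" "x \<in> cl q n K" "y \<in> cl q n K" "i < N"
  shows "p i \<in> K \<or> p (Suc i) \<in> K"
proof -
  consider "0 < i" | "i = 0" "Suc i < N" | "i = 0" "N = 1"
    using assms(4) by atomize_elim arith
  then show ?thesis
    using assms by cases (auto simp: admissible_path_def cl_def)
qed

section \<open>Lipschitz constants\<close>

context
  fixes q :: "3 \<Rightarrow> real^2" and n :: nat and K :: "(real^2) set"
  assumes inj: "inj q" and conn: "conn q n K" and ne: "K \<noteq> {}" and KV: "K \<subseteq> V q n"
begin

lemma finite_cl: "finite (cl q n K)"
  by (rule finite_subset[OF _ finite_V[of q n]]) (use KV in \<open>auto simp: cl_def bdry_def\<close>)

lemma distinct_pair: "\<exists>x y. x \<in> cl q n K \<and> y \<in> cl q n K \<and> x \<noteq> y"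
proof -
  obtain x where x: "x \<in> K"
    using ne by blast
  then obtain y where y: "adj q n y x"
    using KV ex_neighbour by blast
  then have "y \<noteq> x"
    using adj_irrefl[OF inj] by blast
  moreover have "y \<in> cl q n K" "x \<in> cl q n K"
    using neighbour_in_cl[OF x y] x by (auto simp: cl_def)
  ultimately show ?thesis
    by blast
qed

lemma quotient_eq:
  assumes "x \<in> cl q n K" "y \<in> cl q n K" "x \<noteq> y"
  shows "ereal \<bar>u x - u y\<bar> / dK q n K x y
    = ereal (\<bar>u x - u y\<bar> / (real (steps q n K x y) * delta n))"
proof -
  have "real (steps q n K x y) * delta n \<noteq> 0"
    using steps_pos[OF conn assms] delta_pos[of n] by simp
  then show ?thesis
    unfolding dK_eq_steps[OF conn assms(1,2)] by (simp only: ereal_divide if_False)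
qed

lemma Lip_set:
  fixes u :: "real^2 \<Rightarrow> real"
  defines "S \<equiv> {ereal \<bar>u x - u y\<bar> / dK q n K x y | x y. x \<in> cl q n K \<and> y \<in> cl q n K \<and> x \<noteq> y}"
  shows "finite S" and "S \<noteq> {}"
proof -
  have "S \<subseteq> (\<lambda>(x, y). ereal \<bar>u x - u y\<bar> / dK q n K x y) ` (cl q n K \<times> cl q n K)"
    by (auto simp: S_def)
  then show "finite S"
    using finite_cl by (meson finite_SigmaI finite_imageI finite_subset)
  show "S \<noteq> {}"
    using distinct_pair by (auto simp: S_def)
qed

lemma Lip_real: "\<exists>L. Lip q n u K = ereal L"
  using Max_in[OF Lip_set, of u] quotient_eq unfolding Lip_def by auto

lemma Lip_le_iff:
  "Lip q n u K \<le> ereal L \<longleftrightarrow>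
    (\<forall>x\<in>cl q n K. \<forall>y\<in>cl q n K. \<bar>u x - u y\<bar> \<le> L * (real (steps q n K x y) * delta n))"
proof -
  have pair: "ereal \<bar>u x - u y\<bar> / dK q n K x y \<le> ereal L
      \<longleftrightarrow> \<bar>u x - u y\<bar> \<le> L * (real (steps q n K x y) * delta n)"
    if "x \<in> cl q n K" "y \<in> cl q n K" "x \<noteq> y" for x y
    using quotient_eq[OF that] steps_pos[OF conn that] delta_pos[of n]
    by (simp add: pos_divide_le_eq)
  have "Lip q n u K \<le> ereal L \<longleftrightarrow>
    (\<forall>x\<in>cl q n K. \<forall>y\<in>cl q n K. x \<noteq> y \<longrightarrow> ereal \<bar>u x - u y\<bar> / dK q n K x y \<le> ereal L)"
    unfolding Lip_def Max_le_iff[OF Lip_set] by blast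
  also have "\<dots> \<longleftrightarrow>
    (\<forall>x\<in>cl q n K. \<forall>y\<in>cl q n K. \<bar>u x - u y\<bar> \<le> L * (real (steps q n K x y) * delta n))"
    using pair by force
  finally show ?thesis .
qed

lemma Lip_nonneg:
  assumes "Lip q n u K \<le> ereal L"
  shows "0 \<le> L"
proof -
  obtain x y where xy: "x \<in> cl q n K" "y \<in> cl q n K" "x \<noteq> y"
    using distinct_pair by blast
  then have "0 \<le> L * (real (steps q n K x y) * delta n)"
    using assms unfolding Lip_le_iff by (meson abs_ge_zero order_trans)
  moreover have "0 < real (steps q n K x y) * delta n"
    using steps_pos[OF conn xy] delta_pos[of n] by simp
  ultimately show ?thesis
    by (simp add: zero_le_mult_iff)
qed

section \<open>Infinity harmonic functions on a connected set\<close>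

text \<open>If the bound fails somewhere, consider the points of \<open>K\<close> at which the difference between \<open>u\<close>
  and the cone is maximal, and among them a point \<open>y\<close> closest to the vertex \<open>z\<close>.  By maximality \<open>u\<close>
  rises from \<open>y\<close> by at most \<open>l * \<delta>\<close> along an edge, so by harmonicity it falls by at most
  \<open>l * \<delta>\<close>; then the neighbour of \<open>y\<close> one step closer to \<open>z\<close> is a maximum point too.\<close>

lemma cone_comparison_above:
  assumes harm: "inf_harmonic q n u K" and z: "z \<in> bdry q n K" and l: "0 \<le> l"
    and bd: "\<And>x. x \<in> bdry q n K \<Longrightarrow> u x \<le> l * (real (steps q n K z x) * delta n) + a"
    and x: "x \<in> K"
  shows "u x \<le> l * (real (steps q n K z x) * delta n) + a"
proof (rule ccontr)
  define w where "w y = u y - l * (real (steps q n K z y) * delta n)" for y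
  define M where "M = Max (w ` K)"
  assume "\<not> ?thesis"
  then have "a < w x"
    by (simp add: w_def)
  have finK: "finite K"
    using KV finite_V finite_subset by blast
  have w_le: "w y \<le> M" if "y \<in> K" for y
    using that finK by (simp add: M_def)
  have "a < M"
    using \<open>a < w x\<close> w_le[OF x] by linarith
  let ?A = "{y \<in> K. w y = M}"
  have "M \<in> w ` K"
    unfolding M_def by (rule Max_in) (use finK ne in auto)
  then have "\<exists>y. y \<in> ?A"
    by auto
  then obtain y where y: "y \<in> ?A"
    and closest: "\<And>y'. y' \<in> ?A \<Longrightarrow> steps q n K z y \<le> steps q n K z y'"
    using ex_has_least_nat[of "\<lambda>y. y \<in> ?A" _ "steps q n K z"] by blast
  have yK: "y \<in> K" and yM: "w y = M"
    using y by auto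
  have zcl: "z \<in> cl q n K"
    using z by (simp add: cl_def)
  have cl_le: "w y' \<le> M" if "y' \<in> cl q n K" for y'
    using that bd[of y'] w_le[of y'] \<open>a < M\<close> by (fastforce simp: cl_def w_def)
  have rise: "u b - u y \<le> l * delta n" if b: "adj q n b y" for b
  proof -
    have "real (steps q n K z b) \<le> real (steps q n K z y) + 1"
      using steps_edge[OF conn zcl yK b] by linarith
    then have "l * delta n * real (steps q n K z b) \<le> l * delta n * (real (steps q n K z y) + 1)"
      using l delta_pos[of n] by (intro mult_left_mono) auto
    then show ?thesis
      using cl_le[OF neighbour_in_cl[OF yK b]] yM by (simp add: w_def algebra_simps)
  qed
  obtain c where c: "adj q n c y" "steps q n K z c + 1 \<le> steps q n K z y"
    using closer_neighbour[OF conn z yK] by blast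
  have "inf_laplacian q n u y = 0"
    using harm yK by (simp add: inf_harmonic_def)
  then have "u y - u c \<le> l * delta n"
    using harmonic_balance(2)[OF _ c(1)] rise by force
  moreover have "l * delta n * (real (steps q n K z c) + 1) \<le> l * delta n * real (steps q n K z y)"
    using l delta_pos[of n] c(2) by (intro mult_left_mono) auto
  ultimately have "M \<le> w c"
    using yM by (simp add: w_def algebra_simps)
  moreover have c_cl: "c \<in> cl q n K"
    using neighbour_in_cl[OF yK c(1)] .
  ultimately have "w c = M"
    using cl_le by force
  show False
  proof (cases "c \<in> K")
    case True
    then show False
      using closest[of c] \<open>w c = M\<close> c(2) by simp
  next
    case False
    then show False
      using c_cl bd[of c] \<open>w c = M\<close> \<open>a < M\<close> by (auto simp: cl_def w_def)
  qed
qed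

text \<open>Following steepest ascent, every step rises at least as much as the previous one, because
  an infinity harmonic function can rise as much as it has just fallen in the opposite
  direction.  Instead of building the path, consider the points of \<open>K\<close> that lie above \<open>u x\<close> by at
  least \<open>s\<close> per step of distance from \<open>x\<close> and from which a further rise by \<open>s\<close> is possible.  If no
  boundary point satisfied the claim, the next point of the ascent from the highest of them would be
  one of them as well.\<close>

lemma ascent_to_boundary:
  assumes harm: "inf_harmonic q n u K" and x: "x \<in> K"
    and b: "adj q n b x" "s \<le> u b - u x" and s: "0 < s"
  shows "\<exists>z\<in>bdry q n K. s * real (steps q n K x z) \<le> u z - u x"
proof (rule ccontr)
  assume none: "\<not> ?thesis"
  define A where "A = {z \<in> K. s * real (steps q n K x z) \<le> u z - u x \<and>
    (\<exists>b. adj q n b z \<and> s \<le> u b - u z)}"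
  have xcl: "x \<in> cl q n K"
    using x by (simp add: cl_def)
  have "x \<in> A"
    using x b by (auto simp: A_def)
  have "A \<subseteq> V q n"
    using KV by (auto simp: A_def)
  then have finA: "finite A"
    using finite_V finite_subset by blast
  obtain z where z: "z \<in> A" and top: "\<And>z'. z' \<in> A \<Longrightarrow> u z' \<le> u z"
  proof -
    have "Max (u ` A) \<in> u ` A"
      using finA \<open>x \<in> A\<close> by (intro Max_in) auto
    then obtain z where "z \<in> A" "u z = Max (u ` A)"
      by auto
    then show ?thesis
      using that[of z] finA by simp
  qed
  obtain c where zK: "z \<in> K" and rise: "s * real (steps q n K x z) \<le> u z - u x"
    and c: "adj q n c z" "s \<le> u c - u z"
    using z by (auto simp: A_def)
  have "real (steps q n K x c) \<le> real (steps q n K x z) + 1"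
    using steps_edge[OF conn xcl zK c(1)] by linarith
  then have "s * real (steps q n K x c) \<le> s * (real (steps q n K x z) + 1)"
    using s by (intro mult_left_mono) auto
  then have rise_c: "s * real (steps q n K x c) \<le> u c - u x"
    using rise c(2) by (simp add: algebra_simps)
  then have "c \<notin> bdry q n K"
    using none by blast
  then have cK: "c \<in> K"
    using neighbour_in_cl[OF zK c(1)] by (simp add: cl_def)
  then have "inf_laplacian q n u c = 0"
    using harm by (simp add: inf_harmonic_def)
  then obtain d where "adj q n d c" "u c - u z \<le> u d - u c"
    using harmonic_balance(2) adj_sym[OF c(1)] by blast
  with c(2) have "adj q n d c" "s \<le> u d - u c"
    by auto
  with cK rise_c have "c \<in> A"
    by (auto simp: A_def)
  with top[of c] c(2) s show False
    by linarith
qed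

lemma edge_bound:
  assumes harm: "inf_harmonic q n u K" and L: "0 \<le> L"
    and bd: "\<And>y z. y \<in> bdry q n K \<Longrightarrow> z \<in> bdry q n K \<Longrightarrow>
      \<bar>u y - u z\<bar> \<le> L * (real (steps q n K y z) * delta n)"
    and x: "x \<in> K" and y: "adj q n y x"
  shows "\<bar>u y - u x\<bar> \<le> L * delta n"
proof (cases "u y = u x")
  case True
  then show ?thesis
    using L delta_pos[of n] by simp
next
  case False
  define s where "s = \<bar>u y - u x\<bar>"
  have s: "0 < s"
    using False by (simp add: s_def)
  have lap: "inf_laplacian q n u x = 0"
    using harm x by (simp add: inf_harmonic_def)
  have harm': "inf_harmonic q n (\<lambda>y. - u y) K"
    using inf_harmonic_uminus[OF harm KV] .
  have "\<exists>b. adj q n b x \<and> s \<le> u b - u x" "\<exists>a. adj q n a x \<and> s \<le> u x - u a"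
    using harmonic_balance[OF lap y] y unfolding s_def by (auto simp: abs_if)
  then obtain a b where b: "adj q n b x" "s \<le> u b - u x" and a: "adj q n a x" "s \<le> u x - u a"
    by blast
  \<comment> \<open>Prolong the edge upwards to \<open>z\<close> and, passing to \<open>- u\<close>, downwards to \<open>t\<close>.\<close>
  obtain z where z: "z \<in> bdry q n K" "s * real (steps q n K x z) \<le> u z - u x"
    using ascent_to_boundary[OF harm x b s] by blast
  obtain t where t: "t \<in> bdry q n K" "s * real (steps q n K x t) \<le> u x - u t"
    using ascent_to_boundary[OF harm' x a(1) _ s] a(2) by auto
  have cl: "x \<in> cl q n K" "z \<in> cl q n K" "t \<in> cl q n K"
    using x z t by (auto simp: cl_def)
  have "x \<noteq> z"
    using x z(1) by (auto simp: bdry_def)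
  then have pos: "0 < steps q n K x z"
    using steps_pos[OF conn cl(1,2)] by simp
  have "real (steps q n K z t) \<le> real (steps q n K x z) + real (steps q n K x t)"
    using steps_triangle[OF conn cl(2,3) x] steps_sym[of q n K z x] by linarith
  then have "s * real (steps q n K z t) \<le> s * (real (steps q n K x z) + real (steps q n K x t))"
    using s by (intro mult_left_mono) auto
  also have "\<dots> \<le> u z - u t"
    using z(2) t(2) by (simp add: algebra_simps)
  also have "\<dots> \<le> L * (real (steps q n K z t) * delta n)"
    using bd[OF z(1) t(1)] by linarith
  finally have "s * real (steps q n K z t) \<le> (L * delta n) * real (steps q n K z t)"
    by (simp add: algebra_simps)
  moreover have "0 < s * (real (steps q n K x z) + real (steps q n K x t))"
    using s pos by simp
  then have "z \<noteq> t"
    using z(2) t(2) by (auto simp: algebra_simps)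
  then have "0 < steps q n K z t"
    using steps_pos[OF conn cl(2,3)] by simp
  ultimately show ?thesis
    by (simp add: s_def)
qed

lemma Lip_minimal_of_inf_harmonic:
  assumes harm: "inf_harmonic q n u K" and uv: "\<And>y. y \<in> bdry q n K \<Longrightarrow> u y = v y"
  shows "Lip q n u K \<le> Lip q n v K"
proof -
  obtain L where L: "Lip q n v K = ereal L"
    using Lip_real by blast
  then have L0: "0 \<le> L"
    using Lip_nonneg[of v L] by simp
  have v: "\<bar>v x - v y\<bar> \<le> L * (real (steps q n K x y) * delta n)"
    if "x \<in> cl q n K" "y \<in> cl q n K" for x y
    using L Lip_le_iff[of v L] that by simp
  have bd: "\<bar>u y - u z\<bar> \<le> L * (real (steps q n K y z) * delta n)"
    if "y \<in> bdry q n K" "z \<in> bdry q n K" for y z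
    using v[of y z] uv that by (simp add: cl_def)
  have edge: "\<bar>u y - u x\<bar> \<le> L * delta n" if "adj q n y x" "x \<in> K \<or> y \<in> K" for x y
    using that edge_bound[OF harm L0 bd] adj_sym abs_minus_commute by metis
  have "\<bar>u x - u y\<bar> \<le> L * (real (steps q n K x y) * delta n)"
    if cl: "x \<in> cl q n K" "y \<in> cl q n K" for x y
  proof -
    obtain N p where N: "N = steps q n K x y" and p: "admissible_path q n K x y N p"
      using conn_path[OF conn cl] by blast
    have "\<bar>u (p 0) - u (p i)\<bar> \<le> L * (real i * delta n)" if "i \<le> N" for i
      using that
    proof (induction i)
      case (Suc i)
      have "\<bar>u (p i) - u (p (Suc i))\<bar> \<le> L * delta n"
      proof (rule edge)
        show "adj q n (p i) (p (Suc i))"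
          using Suc.prems p by (simp add: admissible_path_def)
        show "p (Suc i) \<in> K \<or> p i \<in> K"
          using admissible_path_edge_meets[OF p cl, of i] Suc.prems by auto
      qed
      then show ?case
        using Suc by (simp add: algebra_simps)
    qed simp
    from this[of N] show ?thesis
      using p by (simp add: admissible_path_def N)
  qed
  then show ?thesis
    unfolding L Lip_le_iff by blast
qed

end

section \<open>Testing on a single vertex\<close>

context
  fixes q :: "3 \<Rightarrow> real^2" and n :: nat and x :: "real^2"
  assumes inj: "inj q" and xV: "x \<in> V q n"
begin

lemma bdry_singleton: "bdry q n {x} = {y. adj q n y x}"
  using adj_irrefl[OF inj] by (auto simp: bdry_def dest: adj_in_V)

lemma singleton_path_two:
  assumes "adj q n y x" "adj q n z x"
  shows "\<exists>p. admissible_path q n {x} y z 2 p"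
  using admissible_path_append[OF admissible_path_edge[OF assms(1)]
      admissible_path_edge[OF adj_sym[OF assms(2)]], of "{x}"]
  by (auto simp: numeral_2_eq_2)

lemma conn_singleton: "conn q n {x}"
proof -
  have "\<exists>N p. admissible_path q n {x} y z N p" if yz: "y \<in> cl q n {x}" "z \<in> cl q n {x}" for y z
  proof -
    consider "y = z" | "y = x" "adj q n z x" | "adj q n y x" "z = x" | "adj q n y x" "adj q n z x"
      using yz unfolding cl_def bdry_singleton by blast
    then show ?thesis
    proof cases
      case 1
      then show ?thesis
        using admissible_path_refl[of q n "{x}" z] by blast
    next
      case 2
      then show ?thesis
        using admissible_path_edge[OF adj_sym, of q n z x "{x}"] by blast
    next
      case 3
      then show ?thesis
        using admissible_path_edge[of q n y x "{x}"] by blast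
    next
      case 4
      then show ?thesis
        using singleton_path_two by blast
    qed
  qed
  then show ?thesis
    using dK_eq_steps_if_path unfolding conn_def by fastforce
qed

lemma steps_singleton_centre:
  assumes "adj q n y x"
  shows "steps q n {x} y x = 1"
proof -
  have "steps q n {x} y x \<le> 1"
    using steps_le admissible_path_edge assms by blast
  moreover have "y \<noteq> x"
    using assms adj_irrefl[OF inj] by blast
  then have "0 < steps q n {x} y x"
    using assms by (intro steps_pos conn_singleton) (auto simp: cl_def bdry_singleton)
  ultimately show ?thesis
    by linarith
qed

lemma steps_singleton_rim:
  assumes "adj q n y x" "adj q n z x" "y \<noteq> z"
  shows "steps q n {x} y z = 2"
proof -
  have bd: "y \<in> bdry q n {x}" "z \<in> bdry q n {x}"
    using assms by (auto simp: bdry_singleton)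
  then have cl: "y \<in> cl q n {x}" "z \<in> cl q n {x}"
    by (auto simp: cl_def)
  have "steps q n {x} y z \<le> 2"
    using steps_le singleton_path_two assms by blast
  moreover have "0 < steps q n {x} y z"
    using steps_pos conn_singleton cl assms(3) by blast
  moreover have "steps q n {x} y z \<noteq> 1"
    using conn_path[OF conn_singleton cl] bd by (auto simp: admissible_path_def)
  ultimately show ?thesis
    by linarith
qed

text \<open>The cone with vertex at a lowest neighbour \<open>a\<close> whose slope makes it equal to \<open>u b\<close>
  at all the other neighbours takes at \<open>x\<close> the midpoint value.\<close>

lemma cone_test_above:
  assumes cone: "\<And>z l c. z \<in> bdry q n {x} \<Longrightarrow> 0 \<le> l \<Longrightarrow>
      (\<And>y. y \<in> bdry q n {x} \<Longrightarrow> u y \<le> l * (real (steps q n {x} z y) * delta n) + c) \<Longrightarrow>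
      u x \<le> l * (real (steps q n {x} z x) * delta n) + c"
    and a: "adj q n a x" and ab: "\<And>y. adj q n y x \<Longrightarrow> u a \<le> u y \<and> u y \<le> u b"
  shows "2 * u x \<le> u a + u b"
proof -
  define l where "l = (u b - u a) / (2 * delta n)"
  have l: "l * (1 * delta n) = (u b - u a) / 2" "l * (2 * delta n) = u b - u a"
    using delta_pos[of n] by (simp_all add: l_def)
  have "u x \<le> l * (real (steps q n {x} a x) * delta n) + u a"
  proof (rule cone)
    show "a \<in> bdry q n {x}"
      using a by (simp add: bdry_singleton)
    show "0 \<le> l"
      using ab[OF a] delta_pos[of n] by (simp add: l_def)
    show "u y \<le> l * (real (steps q n {x} a y) * delta n) + u a" if "y \<in> bdry q n {x}" for y
      using that ab steps_singleton_rim[OF a, of y] l(2)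
      by (cases "y = a") (auto simp: bdry_singleton)
  qed
  then show ?thesis
    using l(1) by (simp add: steps_singleton_centre[OF a])
qed

end

section \<open>The equivalences\<close>

lemma inf_harmonic_subset:
  "inf_harmonic q n u A \<Longrightarrow> K \<subseteq> A \<Longrightarrow> inf_harmonic q n u K"
  by (auto simp: inf_harmonic_def)

text \<open>In this form the second half is the first half for \<open>- u\<close>.\<close>

lemma comparison_with_cones_steps:
  "comparison_with_cones q n u \<longleftrightarrow>
    (\<forall>K z l a. K \<noteq> {} \<and> K \<subseteq> V q n - V q 0 \<and> conn q n K \<and> z \<in> bdry q n K \<and> 0 \<le> l \<longrightarrow>
      ((\<forall>x\<in>bdry q n K. u x \<le> l * (real (steps q n K z x) * delta n) + a) \<longrightarrow>
        (\<forall>x\<in>K. u x \<le> l * (real (steps q n K z x) * delta n) + a)) \<and>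
      ((\<forall>x\<in>bdry q n K. - u x \<le> l * (real (steps q n K z x) * delta n) + - a) \<longrightarrow>
        (\<forall>x\<in>K. - u x \<le> l * (real (steps q n K z x) * delta n) + - a)))"
proof -
  have up: "ereal (u x) \<le> ereal l * dK q n K z x + ereal a \<longleftrightarrow>
      u x \<le> l * (real (steps q n K z x) * delta n) + a"
    and down: "ereal (u x) \<ge> - ereal l * dK q n K z x + ereal a \<longleftrightarrow>
      - u x \<le> l * (real (steps q n K z x) * delta n) + - a"
    if "conn q n K" "z \<in> bdry q n K" "x \<in> K \<union> bdry q n K" for K z x l a
    using dK_eq_steps[OF that(1), of z x] that by (auto simp: cl_def)
  show ?thesis
    unfolding comparison_with_cones_def
    by (intro arg_cong[where f = All] ext imp_cong refl conj_cong ball_cong)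
      (use up down in blast)+
qed

lemma comparison_with_cones_iff_inf_harmonic:
  assumes inj: "inj q"
  shows "comparison_with_cones q n u \<longleftrightarrow> inf_harmonic q n u (V q n - V q 0)"
proof
  assume cones: "comparison_with_cones q n u"
  show "inf_harmonic q n u (V q n - V q 0)"
    unfolding inf_harmonic_def
  proof
    fix x assume x: "x \<in> V q n - V q 0"
    then have xV: "x \<in> V q n"
      by simp
    note conn = conn_singleton[OF inj xV]
    obtain a b where ab: "adj q n a x" "adj q n b x"
      "\<And>y. adj q n y x \<Longrightarrow> u a \<le> u y \<and> u y \<le> u b"
      using obtain_extremal_neighbours[OF xV, of u] by blast
    have "2 * u x \<le> u a + u b"
    proof (rule cone_test_above[OF inj xV _ ab(1,3)])
      fix z l c assume "z \<in> bdry q n {x}" "(0::real) \<le> l"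
        "\<And>y. y \<in> bdry q n {x} \<Longrightarrow> u y \<le> l * (real (steps q n {x} z y) * delta n) + c"
      then show "u x \<le> l * (real (steps q n {x} z x) * delta n) + c"
        using cones[unfolded comparison_with_cones_steps, rule_format, of "{x}" z l c] conn x by auto
    qed
    moreover have "2 * - u x \<le> - u b + - u a"
    proof (rule cone_test_above[OF inj xV _ ab(2), where u = "\<lambda>y. - u y"])
      fix z l c assume "z \<in> bdry q n {x}" "(0::real) \<le> l"
        "\<And>y. y \<in> bdry q n {x} \<Longrightarrow> - u y \<le> l * (real (steps q n {x} z y) * delta n) + c"
      then show "- u x \<le> l * (real (steps q n {x} z x) * delta n) + c"
        using cones[unfolded comparison_with_cones_steps, rule_format, of "{x}" z l "- c"] conn x by auto
    qed (use ab in auto)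
    ultimately show "inf_laplacian q n u x = 0"
      using inf_laplacian_extremal[of q n a x b u] ab by simp
  qed
next
  assume harm: "inf_harmonic q n u (V q n - V q 0)"
  show "comparison_with_cones q n u"
    unfolding comparison_with_cones_steps
  proof (intro allI impI, elim conjE)
    fix K z l a
    assume K: "K \<noteq> {}" "K \<subseteq> V q n - V q 0" and conn: "conn q n K"
      and z: "z \<in> bdry q n K" and l: "0 \<le> (l::real)"
    have KV: "K \<subseteq> V q n"
      using K by blast
    have up: "inf_harmonic q n u K"
      using inf_harmonic_subset[OF harm K(2)] .
    have down: "inf_harmonic q n (\<lambda>y. - u y) K"
      using inf_harmonic_uminus[OF up KV] .
    show "((\<forall>x\<in>bdry q n K. u x \<le> l * (real (steps q n K z x) * delta n) + a) \<longrightarrow>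
        (\<forall>x\<in>K. u x \<le> l * (real (steps q n K z x) * delta n) + a)) \<and>
      ((\<forall>x\<in>bdry q n K. - u x \<le> l * (real (steps q n K z x) * delta n) + - a) \<longrightarrow>
        (\<forall>x\<in>K. - u x \<le> l * (real (steps q n K z x) * delta n) + - a))"
      using cone_comparison_above[OF inj conn K(1) KV up z l]
        cone_comparison_above[OF inj conn K(1) KV down z l] by blast
  qed
qed

text \<open>For necessity, the competitor \<open>v\<close> on \<open>K = {x}\<close> replaces \<open>u x\<close> by the midpoint.  Its
  Lipschitz constant is at most \<open>(u b - u a) / (2 * \<delta>)\<close>, and any other value at \<open>x\<close> exceeds this
  slope along the edge to \<open>a\<close> or to \<open>b\<close>.\<close>

lemma AMLE_iff_inf_harmonic:
  assumes inj: "inj q"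
  shows "u \<in> AMLE q n \<longleftrightarrow> inf_harmonic q n u (V q n - V q 0)"
proof
  assume AMLE: "u \<in> AMLE q n"
  show "inf_harmonic q n u (V q n - V q 0)"
    unfolding inf_harmonic_def
  proof
    fix x assume x: "x \<in> V q n - V q 0"
    then have xV: "x \<in> V q n" and KV: "{x} \<subseteq> V q n"
      by auto
    note conn = conn_singleton[OF inj xV]
    note Lip_le = Lip_le_iff[OF inj conn insert_not_empty KV]
    obtain a b where ab: "adj q n a x" "adj q n b x"
      "\<And>y. adj q n y x \<Longrightarrow> u a \<le> u y \<and> u y \<le> u b"
      using obtain_extremal_neighbours[OF xV, of u] by blast
    define v where "v = u(x := (u a + u b) / 2)"
    define L where "L = (u b - u a) / 2 / delta n"
    have L: "L * (1 * delta n) = (u b - u a) / 2" "L * (2 * delta n) = u b - u a"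
      using delta_pos[of n] by (simp_all add: L_def)
    have v: "v y = u y" if "adj q n y x" for y
      using that adj_irrefl[OF inj] by (auto simp: v_def)
    have cl: "y \<in> cl q n {x} \<longleftrightarrow> y = x \<or> adj q n y x" for y
      by (simp add: cl_def bdry_singleton[OF inj xV])
    note steps = steps_singleton_centre[OF inj xV] steps_singleton_rim[OF inj xV]
    have centre: "\<bar>v y - v x\<bar> \<le> L * (real (steps q n {x} y x) * delta n)"
      if "adj q n y x" for y
    proof -
      have "v x = (u a + u b) / 2"
        by (simp add: v_def)
      then have "\<bar>v y - v x\<bar> \<le> L * (1 * delta n)"
        using ab(3)[OF that] v[OF that] unfolding L(1) by (auto simp: abs_if)
      then show ?thesis
        by (simp add: steps(1)[OF that])
    qed
    have rim: "\<bar>v y - v z\<bar> \<le> L * (real (steps q n {x} y z) * delta n)"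
      if "adj q n y x" "adj q n z x" "y \<noteq> z" for y z
      using ab(3)[OF that(1)] ab(3)[OF that(2)] L(2) v[OF that(1)] v[OF that(2)] steps(2)[OF that]
      by (simp add: abs_le_iff)
    have "\<bar>v y - v z\<bar> \<le> L * (real (steps q n {x} y z) * delta n)"
      if yz: "y \<in> cl q n {x}" "z \<in> cl q n {x}" for y z
    proof -
      consider "y = z" | "y = x" "adj q n z x" | "z = x" "adj q n y x"
        | "adj q n y x" "adj q n z x" "y \<noteq> z"
        using yz unfolding cl by blast
      then show ?thesis
      proof cases
        case 2
        then show ?thesis
          using centre[of z] steps_sym[of q n "{x}" x z] by (simp add: abs_minus_commute)
      qed (use centre rim in auto)
    qed
    then have "Lip q n v {x} \<le> ereal L"
      unfolding Lip_le by blast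
    moreover have "Lip q n u {x} \<le> Lip q n v {x}"
      using AMLE x conn v unfolding AMLE_def by (auto simp: bdry_singleton[OF inj xV])
    ultimately have "Lip q n u {x} \<le> ereal L"
      by (rule order_trans[rotated])
    then have *: "\<bar>u y - u x\<bar> \<le> (u b - u a) / 2" if "adj q n y x" for y
      using that steps(1)[OF that] L(1) cl[of x] cl[of y] unfolding Lip_le by force
    have "u a + u b - 2 * u x = 0"
      using *[OF ab(1)] *[OF ab(2)] by (auto simp: abs_if split: if_splits)
    then show "inf_laplacian q n u x = 0"
      using inf_laplacian_extremal[of q n a x b u] ab by simp
  qed
next
  assume harm: "inf_harmonic q n u (V q n - V q 0)"
  have "Lip q n u K \<le> Lip q n v K"
    if K: "K \<noteq> {}" "K \<subseteq> V q n - V q 0" "conn q n K" and uv: "\<forall>y\<in>bdry q n K. u y = v y" for K v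
  proof -
    have KV: "K \<subseteq> V q n"
      using K by blast
    show ?thesis
      using Lip_minimal_of_inf_harmonic[OF inj K(3,1) KV inf_harmonic_subset[OF harm K(2)]] uv
      by blast
  qed
  then show "u \<in> AMLE q n"
    unfolding AMLE_def by blast
qed

theorem proposition3p3:
  fixes q :: "3 \<Rightarrow> real^2" and n :: nat and u :: "real^2 \<Rightarrow> real"
  assumes equilateral: "\<And>i j. i \<noteq> j \<Longrightarrow> dist (q i) (q j) = 1"
  shows "(u \<in> AMLE q n \<longleftrightarrow> comparison_with_cones q n u) \<and>
         (comparison_with_cones q n u \<longleftrightarrow> inf_harmonic q n u (V q n - V q 0)) \<and>
         (inf_harmonic q n u (V q n - V q 0) \<longleftrightarrow> u \<in> AM q n)"
proof -
  have "inj q"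
    using equilateral by (metis injI dist_self zero_neq_one)
  then show ?thesis
    using AMLE_iff_inf_harmonic comparison_with_cones_iff_inf_harmonic AM_iff_inf_harmonic by blast
qed

end
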